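(* Let $\Omega$ be an arbitrary non-empty set and $\vec{\Omega}\colon\mathbb{N}\to\Omega$ a sequence. For any $A\subseteq\Omega$, $$\overline{P}(A)=\limsup_{n\to\infty}\vec{P}(n)(A)=\limsup_{n\to\infty}\frac1n\sum_{i=1}^n\chi_A\left(\vec{\Omega}(i)\right).$$
   Context: $\chi_A$ is the indicator function of $A$. $L^\infty$ is the Banach space of bounded functions $X\colon\Omega\to\mathbb{R}$ with the supremum norm; $(L^\infty)^*$ is its topological dual with the weak* topology. $\operatorname{PF}(\Omega)=\{E\in(L^\infty)^*\colon E(X)\ge0\text{ whenever }X\ge0,\ E(\chi_\Omega)=1\}$, with the subspace topology. The empirical probabilities are $\vec{P}(n)=\big(A\mapsto\frac1n\sum_{i=1}^n\chi_A(\vec{\Omega}(i))\big)$, and the empirical linear previsions $\vec{E}\colon\mathbb{N}\to\operatorname{PF}(\Omega)$ are $\vec{E}(n)=\big(X\mapsto\frac1n\sum_{i=1}^nX(\vec{\Omega}(i))\big)$. $\operatorname{CP}(\vec{E})$ is the set of cluster points of $\vec E$: those $E$ such that for every neighbourhood $N$ of $E$ and every $n_0\in\mathbb{N}$ there is $n\ge n_0$ with $\vec{E}(n)\in N$. The upper probability is $\overline{P}(A)=\sup\{E(\chi_A)\colon E\in\operatorname{CP}(\vec{E})\}$ for $A\subseteq\Omega$. *)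

theory Defs
  imports "HOL-Probability.Discrete_Topology"
begin

text \<open>
  The underlying set \<open>\<Omega>\<close> is the type \<open>'a\<close>.  The space of all bounded functions \<open>\<Omega> \<rightarrow> \<real>\<close> with
  the supremum norm is the library's space of bounded continuous functions on \<open>\<Omega>\<close> equipped with
  the discrete topology; lemma \<open>bounded_function_in_linfty\<close> states that no bounded function is lost.
\<close>

type_synonym 'a linfty = "'a discrete \<Rightarrow>\<^sub>C real"

type_synonym 'a linfty_dual = "'a linfty \<Rightarrow>\<^sub>L real"

lemma continuous_on_discrete: "continuous_on S (f :: 'a discrete \<Rightarrow> 'b::topological_space)"
  by (metis continuous_on_open_vimage continuous_on_subset open_UNIV open_discrete subset_UNIV)

lemma bounded_function_in_linfty:
  fixes f :: "'a \<Rightarrow> real"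
  assumes "bounded (range f)"
  shows "\<exists>X :: 'a linfty. \<forall>w. apply_bcontfun X (discrete w) = f w"
proof -
  have "f \<circ> of_discrete \<in> bcontfun"
    using assms by (auto simp: bcontfun_def continuous_on_discrete intro: bounded_subset)
  then obtain X :: "'a linfty" where "f \<circ> of_discrete = apply_bcontfun X"
    by (rule bcontfunE)
  then show ?thesis
    by (metis comp_apply discrete_inverse UNIV_I)
qed

definition chi :: "'a set \<Rightarrow> 'a linfty" where
  "chi A = Bcontfun (\<lambda>w. indicator A (of_discrete w))"

lemma apply_chi: "apply_bcontfun (chi A) w = indicator A (of_discrete w)"
  unfolding chi_def
  by (subst Bcontfun_inverse)
    (auto intro!: bcontfun_normI[where b = 1] continuous_on_discrete simp: indicator_def)

text \<open>
  For functionals with values in \<open>\<real>\<close>, the strong operator topology is the topology of pointwise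
  convergence on \<open>L\<^sup>\<infinity>\<close>, that is, the weak* topology of the dual.
\<close>

abbreviation weak_star_topology :: "'a linfty_dual topology" where
  "weak_star_topology \<equiv> strong_operator_topology"

definition PF :: "'a linfty_dual set" where
  "PF = {E. (\<forall>X. (\<forall>w. 0 \<le> apply_bcontfun X w) \<longrightarrow> 0 \<le> blinfun_apply E X)
            \<and> blinfun_apply E (chi UNIV) = 1}"

definition PF_topology :: "'a linfty_dual topology" where
  "PF_topology = subtopology weak_star_topology PF"

text \<open>
  Sequences are indexed from 1.  Since Isabelle's naturals start at 0, the value \<open>om 0\<close> is never
  used, and the value of the following two sequences at index 0 is a dummy (namely 0).
\<close>

definition empirical_prob :: "(nat \<Rightarrow> 'a) \<Rightarrow> nat \<Rightarrow> 'a set \<Rightarrow> real" where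
  "empirical_prob om n A = 1 / real n * (\<Sum>i=1..n. indicator A (om i))"

lift_definition empirical_prevision :: "(nat \<Rightarrow> 'a) \<Rightarrow> nat \<Rightarrow> 'a linfty_dual"
  is "\<lambda>om n X. 1 / real n * (\<Sum>i=1..n. apply_bcontfun X (discrete (om i)))"
proof -
  fix om :: "nat \<Rightarrow> 'a" and n :: nat
  have "bounded_linear (\<lambda>X :: 'a linfty. apply_bcontfun X w)" for w
    by (rule bounded_linear_intro[where K = 1])
      (use norm_bounded in \<open>auto simp: plus_bcontfun.rep_eq scaleR_bcontfun.rep_eq simp flip: real_norm_def\<close>)
  then show "bounded_linear
      (\<lambda>X :: 'a linfty. 1 / real n * (\<Sum>i=1..n. apply_bcontfun X (discrete (om i))))"
    by (intro bounded_linear_const_mult bounded_linear_sum)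
qed

lemma empirical_prevision_in_PF:
  assumes "n \<ge> 1"
  shows "empirical_prevision om n \<in> PF"
  using assms
  by (auto simp: PF_def empirical_prevision.rep_eq apply_chi intro!: divide_nonneg_nonneg sum_nonneg)

text \<open>
  Cluster points, in the space \<open>T\<close>, of a sequence indexed from 1.  A neighbourhood of a point is any
  subset of the space that includes an open set containing the point.
\<close>

definition cluster_points :: "'b topology \<Rightarrow> (nat \<Rightarrow> 'b) \<Rightarrow> 'b set" where
  "cluster_points T s = {x \<in> topspace T.
     \<forall>N. N \<subseteq> topspace T \<and> (\<exists>U. openin T U \<and> x \<in> U \<and> U \<subseteq> N) \<longrightarrow>
       (\<forall>n0\<ge>1. \<exists>n\<ge>n0. s n \<in> N)}"

definition CP :: "(nat \<Rightarrow> 'a) \<Rightarrow> 'a linfty_dual set" where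
  "CP om = cluster_points PF_topology (empirical_prevision om)"

text \<open>
  The supremum is taken in the extended reals, so that it carries its usual meaning without any
  side condition on the set of cluster points.
\<close>

definition upper_prob :: "(nat \<Rightarrow> 'a) \<Rightarrow> 'a set \<Rightarrow> ereal" where
  "upper_prob om A = (SUP E\<in>CP om. ereal (blinfun_apply E (chi A)))"

end

theory Submission
  imports Defs
begin

text \<open>
  Evaluation at \<open>chi A\<close> is weak* continuous, so every value of a cluster point at \<open>chi A\<close> is a cluster
  value of the relative frequencies and hence at most their limsup.  Conversely, along a
  subsequence of the frequencies that converges to the limsup, Tychonoff's theorem gives the
  previsions a pointwise cluster point; linearity, positivity, normalisation and the norm bound are
  closed conditions on finitely many coordinates, so they pass to this cluster point.
\<close>

text \<open>Confines all previsions to a single box of functions; at index 0 the dummy value is 0,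
  since \<open>1 / real 0 = 0\<close>.\<close>

lemma norm_empirical_prevision_le:
  "\<bar>blinfun_apply (empirical_prevision om n) X\<bar> \<le> norm X"
proof -
  have "\<bar>\<Sum>i=1..n. apply_bcontfun X (discrete (om i))\<bar> \<le> (\<Sum>i=1..n. norm X)"
    by (rule order_trans[OF sum_abs sum_mono]) (metis norm_bounded real_norm_def)
  then show ?thesis
    by (cases "n = 0") (auto simp: empirical_prevision.rep_eq abs_mult field_simps)
qed

lemma empirical_prevision_chi:
  "blinfun_apply (empirical_prevision om n) (chi A) = empirical_prob om n A"
  by (simp add: empirical_prevision.rep_eq empirical_prob_def apply_chi discrete_inverse)

text \<open>The strong operator topology is the pullback along \<open>blinfun_apply\<close> of the
  product topology on functions, so weak* questions can be moved to the function space.\<close>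

lemma openin_PF_topology:
  "openin PF_topology U \<longleftrightarrow> (\<exists>W. open W \<and> U = blinfun_apply -` W \<inter> PF)"
  by (auto simp: PF_topology_def openin_subtopology strong_operator_topology_def
      openin_pullback_topology)

lemma topspace_PF_topology: "topspace PF_topology = PF"
  by (auto simp: PF_topology_def strong_operator_topology_topspace)

lemma CP_iff:
  "E \<in> CP om \<longleftrightarrow> E \<in> PF \<and>
     (\<forall>W. open W \<and> blinfun_apply E \<in> W \<longrightarrow>
       (\<exists>\<^sub>F n in sequentially. blinfun_apply (empirical_prevision om n) \<in> W))"
proof (intro iffI conjI allI impI)
  assume E: "E \<in> CP om"
  then show "E \<in> PF"
    by (simp add: CP_def cluster_points_def topspace_PF_topology)
  fix W :: "('a linfty \<Rightarrow> real) set"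
  assume W: "open W \<and> blinfun_apply E \<in> W"
  have "\<exists>n\<ge>n0. empirical_prevision om n \<in> blinfun_apply -` W \<inter> PF" if "n0 \<ge> 1" for n0
  proof -
    have "openin PF_topology (blinfun_apply -` W \<inter> PF)"
      using W openin_PF_topology by blast
    then show ?thesis
      using E W \<open>E \<in> PF\<close> that unfolding CP_def cluster_points_def topspace_PF_topology by blast
  qed
  then show "\<exists>\<^sub>F n in sequentially. blinfun_apply (empirical_prevision om n) \<in> W"
    \<comment> \<open>Here the bound may be 0, so the claim is used at its successor.\<close>
    unfolding frequently_sequentially by (metis IntD1 Suc_leD le_add1 plus_1_eq_Suc vimage_eq)
next
  assume E: "E \<in> PF \<and> (\<forall>W. open W \<and> blinfun_apply E \<in> W \<longrightarrow>
       (\<exists>\<^sub>F n in sequentially. blinfun_apply (empirical_prevision om n) \<in> W))"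
  have "\<exists>n\<ge>n0. empirical_prevision om n \<in> N"
    if U: "openin PF_topology U" "E \<in> U" "U \<subseteq> N" and n0: "n0 \<ge> 1" for U N n0
  proof -
    obtain W where W: "open W" "U = blinfun_apply -` W \<inter> PF"
      using U by (auto simp: openin_PF_topology)
    have "\<exists>\<^sub>F n in sequentially. blinfun_apply (empirical_prevision om n) \<in> W"
      using E U(2) W by simp
    then obtain n where "n \<ge> n0" "blinfun_apply (empirical_prevision om n) \<in> W"
      by (auto simp: frequently_sequentially)
    then show ?thesis
      using W U n0 empirical_prevision_in_PF[of n om] by auto
  qed
  then show "E \<in> CP om"
    using E by (auto simp: CP_def cluster_points_def topspace_PF_topology)
qed

text \<open>Tychonoff: the box is a product of compact intervals.\<close>

lemma compact_abs_le_box: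
  fixes b :: "'i \<Rightarrow> real"
  shows "compact {f. \<forall>i. \<bar>f i\<bar> \<le> b i}"
proof -
  have "compactin (product_topology (\<lambda>i. euclidean) UNIV) (PiE UNIV (\<lambda>i. {- b i..b i}))"
    by (simp add: compactin_PiE)
  moreover have "PiE UNIV (\<lambda>i. {- b i..b i}) = {f. \<forall>i. \<bar>f i\<bar> \<le> b i}"
    by (auto simp: PiE_def Pi_def abs_le_iff minus_le_iff)
  ultimately show ?thesis
    by (simp add: euclidean_product_topology)
qed

text \<open>Inheritance of closed conditions is exported so that the limit of the frequencies along
  \<open>r\<close> can be read off at \<open>chi A\<close>.\<close>

lemma ex_cluster_point_subseq:
  assumes r: "strict_mono r"
  obtains E where "E \<in> CP om"
    and "\<And>C. closed C \<Longrightarrow> \<forall>\<^sub>F n in sequentially. blinfun_apply (empirical_prevision om (r n)) \<in> C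
          \<Longrightarrow> blinfun_apply E \<in> C"
proof -
  define s where "s n = blinfun_apply (empirical_prevision om (r n))" for n
  define F where "F = filtermap s sequentially"
  have "\<forall>\<^sub>F f in F. f \<in> {f. \<forall>X. \<bar>f X\<bar> \<le> norm X}"
    by (simp add: F_def s_def eventually_filtermap norm_empirical_prevision_le)
  moreover have "F \<noteq> bot"
    by (simp add: F_def filtermap_bot_iff)
  ultimately obtain x where x: "\<And>X. \<bar>x X\<bar> \<le> norm X" and cl: "inf (nhds x) F \<noteq> bot"
    using compact_abs_le_box[of norm] unfolding compact_filter by blast
  \<comment> \<open>If the \<open>s n\<close> eventually avoided \<open>W\<close>, then
    \<open>F\<close> and \<open>nhds x\<close> would contain disjoint sets, against
    \<open>cl\<close>.\<close>
  have freq: "\<exists>\<^sub>F n in sequentially. s n \<in> W" if "open W" "x \<in> W" for W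
  proof (rule ccontr)
    assume "\<not> ?thesis"
    then have "\<forall>\<^sub>F f in F. f \<notin> W"
      by (simp add: F_def eventually_filtermap not_frequently)
    moreover have "\<forall>\<^sub>F f in nhds x. f \<in> W"
      using that by (rule eventually_nhds_in_open)
    ultimately have "\<forall>\<^sub>F f in inf (nhds x) F. False"
      unfolding eventually_inf by blast
    then show False
      using cl by (simp add: eventually_False)
  qed
  have closedD: "x \<in> C" if "closed C" "\<forall>\<^sub>F n in sequentially. s n \<in> C" for C
    using freq[of "- C"] that by (auto simp: frequently_def)
  note cont = continuous_intros continuous_on_product_coordinates
  \<comment> \<open>Evaluation at a fixed argument is continuous in the product topology, so each
    such equation defines a closed set, and every \<open>s n\<close> lies in it.\<close>
  have "x \<in> {f. f (X + Y) = f X + f Y}" for X Y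
    by (rule closedD) (auto simp: s_def blinfun.add_right intro!: closed_Collect_eq cont)
  moreover have "x \<in> {f. f (c *\<^sub>R X) = c * f X}" for c X
    by (rule closedD) (auto simp: s_def blinfun.scaleR_right intro!: closed_Collect_eq cont)
  ultimately have "bounded_linear x"
    using x by (intro bounded_linear_intro[where K = 1]) auto
  then have app: "blinfun_apply (Blinfun x) = x"
    by (rule bounded_linear_Blinfun_apply)
  \<comment> \<open>As \<open>r n \<ge> n\<close>, only the dummy index 0 has to be avoided.\<close>
  have ev: "\<forall>\<^sub>F n in sequentially. empirical_prevision om (r n) \<in> PF"
    using eventually_ge_at_top[of 1]
    by eventually_elim (meson empirical_prevision_in_PF order_trans seq_suble[OF r])
  have "x \<in> {f. f (chi UNIV) = 1}"
  proof (rule closedD)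
    show "\<forall>\<^sub>F n in sequentially. s n \<in> {f. f (chi UNIV) = 1}"
      using ev by eventually_elim (simp add: s_def PF_def)
  qed (auto intro!: closed_Collect_eq cont)
  moreover have "x \<in> {f. 0 \<le> f X}" if "\<forall>w. 0 \<le> apply_bcontfun X w" for X
  proof (rule closedD)
    show "\<forall>\<^sub>F n in sequentially. s n \<in> {f. 0 \<le> f X}"
      using ev by eventually_elim (use that in \<open>simp add: s_def PF_def\<close>)
  qed (auto intro!: closed_Collect_le cont)
  ultimately have "Blinfun x \<in> PF"
    by (simp add: PF_def app)
  \<comment> \<open>Visits to \<open>W\<close> along \<open>r\<close> are visits of the whole
    sequence, at indices \<open>r n \<ge> n\<close>.\<close>
  moreover have "\<exists>\<^sub>F n in sequentially. blinfun_apply (empirical_prevision om n) \<in> W"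
    if "open W" "x \<in> W" for W
    using freq[OF that] seq_suble[OF r] unfolding frequently_sequentially s_def
    by (meson order_trans)
  ultimately have "Blinfun x \<in> CP om"
    by (simp add: CP_iff app)
  then show thesis
    using closedD by (intro that[of "Blinfun x"]) (auto simp: app s_def)
qed

text \<open>Otherwise a real \<open>c\<close> lies strictly between: the open set of
  \<open>f\<close> with \<open>c < f (chi A)\<close> contains \<open>E\<close>, so frequencies
  exceed \<open>c\<close> infinitely often, although they are eventually below
  \<open>c\<close>.\<close>

lemma CP_chi_le_limsup:
  assumes "E \<in> CP om"
  shows "ereal (blinfun_apply E (chi A)) \<le> limsup (\<lambda>n. ereal (empirical_prob om n A))"
proof (rule ccontr)
  assume "\<not> ?thesis"
  then obtain c where c: "limsup (\<lambda>n. ereal (empirical_prob om n A)) < ereal c"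
      "c < blinfun_apply E (chi A)"
    by (metis ereal_dense2 less_ereal.simps(1) not_le)
  have "open {f :: 'a linfty \<Rightarrow> real. c < f (chi A)}"
    by (intro open_Collect_less continuous_intros continuous_on_product_coordinates)
  then have "\<exists>\<^sub>F n in sequentially. c < empirical_prob om n A"
    using assms c(2) by (fastforce simp: CP_iff empirical_prevision_chi)
  moreover have "\<forall>\<^sub>F n in sequentially. ereal (empirical_prob om n A) < ereal c"
    using c(1) by (rule Limsup_lessD)
  ultimately show False
    by (auto simp: frequently_def elim!: notE eventually_mono)
qed

lemma limsup_le_upper_prob:
  "limsup (\<lambda>n. ereal (empirical_prob om n A)) \<le> upper_prob om A"
proof -
  define L where "L = limsup (\<lambda>n. ereal (empirical_prob om n A))"
  obtain r where r: "strict_mono r" "((\<lambda>n. ereal (empirical_prob om n A)) \<circ> r) \<longlonglongrightarrow> L"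
    using limsup_subseq_lim unfolding L_def by blast
  obtain E where E: "E \<in> CP om" and
    closedD: "\<And>C. closed C \<Longrightarrow> \<forall>\<^sub>F n in sequentially. blinfun_apply (empirical_prevision om (r n)) \<in> C
      \<Longrightarrow> blinfun_apply E \<in> C"
    using ex_cluster_point_subseq[OF r(1)] by metis
  \<comment> \<open>\<open>L\<close> is an extended real, so it is approached by real thresholds
    \<open>c\<close>, each giving a closed half-space that eventually contains the previsions along
    \<open>r\<close>.\<close>
  have "c \<le> blinfun_apply E (chi A)" if "ereal c < L" for c
  proof -
    have "blinfun_apply E \<in> {f. c \<le> f (chi A)}"
    proof (rule closedD)
      show "closed {f :: 'a linfty \<Rightarrow> real. c \<le> f (chi A)}"
        by (intro closed_Collect_le continuous_intros continuous_on_product_coordinates)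
      show "\<forall>\<^sub>F n in sequentially. blinfun_apply (empirical_prevision om (r n)) \<in> {f. c \<le> f (chi A)}"
        using order_tendstoD(1)[OF r(2) that]
        by eventually_elim (simp add: empirical_prevision_chi)
    qed
    then show ?thesis by simp
  qed
  \<comment> \<open>Were the value at \<open>chi A\<close> below \<open>L\<close>, density would
    give a real \<open>c\<close> strictly between them.\<close>
  then have "L \<le> ereal (blinfun_apply E (chi A))"
    by (metis ereal_dense2 ereal_less_eq(3) leD le_less_linear less_ereal.simps(1))
  also have "\<dots> \<le> upper_prob om A"
    unfolding upper_prob_def using E by (rule SUP_upper)
  finally show ?thesis
    by (simp add: L_def)
qed

theorem corollary2p3:
  fixes om :: "nat \<Rightarrow> 'a" and A :: "'a set"
  shows "upper_prob om A = limsup (\<lambda>n. ereal (empirical_prob om n A))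
       \<and> limsup (\<lambda>n. ereal (empirical_prob om n A))
         = limsup (\<lambda>n. ereal (1 / real n * (\<Sum>i=1..n. indicator A (om i))))"
proof
  show "upper_prob om A = limsup (\<lambda>n. ereal (empirical_prob om n A))"
    by (intro antisym limsup_le_upper_prob)
      (auto simp: upper_prob_def intro!: SUP_least CP_chi_le_limsup)
qed (simp add: empirical_prob_def)

end
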